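(* Let $q$ be a prime power and let $n\geq 2$ be an integer. Let $T_n(q)$ be the total graph of $M_n(\mathbb{F}_q)$, that is, the simple graph with vertex set $M_n(\mathbb{F}_q)$ in which two distinct matrices $a,b\in M_n(\mathbb{F}_q)$ are joined by an edge if and only if $\det(a+b)=0$. Then the independence number of $T_n(q)$ satisfies \[\alpha(T_n(q))\leq q^{n^2-n+1}.\]
   Context: $\mathbb{F}_q$ is the finite field with $q$ elements (of any characteristic, $q$ even or odd) and $M_n(\mathbb{F}_q)$ is the ring of $n\times n$ matrices over $\mathbb{F}_q$. The independence number $\alpha(X)$ of a finite graph $X$ is the maximal size of a set of pairwise non-adjacent vertices. *)

theory Defs
  imports "HOL-Analysis.Determinants" "Graph_Theory.Pair_Digraph"
begin

text \<open>A simple graph is a symmetric loop-free digraph without parallel arcs, as in the locale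
  \<^locale>\<open>pair_graph\<close>.\<close>

definition independent_in :: "'v pair_pre_digraph \<Rightarrow> 'v set \<Rightarrow> bool" where
  "independent_in G S \<longleftrightarrow>
     S \<subseteq> pverts G \<and> (\<forall>u\<in>S. \<forall>v\<in>S. u \<noteq> v \<longrightarrow> (u, v) \<notin> parcs G)"

text \<open>Meaningful only if \<open>pverts G\<close> is finite; then the maximum is over a finite set, which is
  non-empty because the empty set is independent.\<close>

definition independence_number :: "'v pair_pre_digraph \<Rightarrow> nat" where
  "independence_number G = Max (card ` {S. independent_in G S})"

text \<open>The field with \<open>q\<close> elements is a type \<open>'a\<close> of class \<open>{field, finite}\<close> with
  \<open>CARD('a) = q\<close>, and the \<open>n \<times> n\<close> matrices over it form the type \<open>'a ^ 'n ^ 'n\<close>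
  with \<open>CARD('n) = n\<close>.\<close>

definition total_graph :: "('a::{field,finite} ^ 'n ^ 'n) pair_pre_digraph" where
  "total_graph = \<lparr> pverts = UNIV, parcs = {(a, b). a \<noteq> b \<and> det (a + b) = 0} \<rparr>"

lemma pair_graph_total_graph: "pair_graph (total_graph :: ('a::{field,finite} ^ 'n ^ 'n) pair_pre_digraph)"
proof -
  have "sym {(a :: 'a ^ 'n ^ 'n, b). a \<noteq> b \<and> det (a + b) = 0}"
    by (auto simp: sym_def add.commute)
  then show ?thesis
    by unfold_locales (auto simp: total_graph_def symmetric_def)
qed

lemma independence_number_attained:
  assumes "finite (pverts G)"
  shows "\<exists>S. independent_in G S \<and> card S = independence_number G"
    and "independent_in G S \<Longrightarrow> card S \<le> independence_number G"
proof -
  have fin: "finite {S. independent_in G S}"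
    using assms by (auto intro: finite_subset[of _ "Pow (pverts G)"] simp: independent_in_def)
  have "independent_in G {}"
    by (simp add: independent_in_def)
  with fin have "independence_number G \<in> card ` {S. independent_in G S}"
    unfolding independence_number_def by (intro Max_in) auto
  then show "\<exists>S. independent_in G S \<and> card S = independence_number G"
    by auto
  show "independent_in G S \<Longrightarrow> card S \<le> independence_number G"
    unfolding independence_number_def using fin by (intro Max_ge) auto
qed

end

theory Submission
  imports Defs
begin

text \<open>
  Write \<open>q\<close> for the order of the field, \<open>Q = q ^ n\<close>, \<open>N = q ^ (n * n)\<close> and \<open>K = N / Q\<close>, and let
  \<open>S\<close> be an independent set with \<open>s\<close> elements. A singular matrix is one that kills a non-zero
  vector, so independence says that for each \<open>v \<noteq> 0\<close> two different members of \<open>S\<close> never have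
  opposite images under \<open>x \<mapsto> x *v v\<close>.

  In characteristic 2 opposite means equal, hence \<open>x \<mapsto> x *v v\<close> is injective on \<open>S\<close> for a single
  \<open>v\<close>, and \<open>s \<le> Q\<close>, which is at most \<open>q K\<close>.

  In odd characteristic a single \<open>v\<close> gives only about half of the matrix space, and the idea is to
  average over many directions. Let \<open>f v w\<close> count the \<open>x \<in> S\<close> with \<open>x *v v = w\<close>. The sum of
  \<open>f v w * f v (- w)\<close> over \<open>w\<close> counts opposite pairs, so it is at most 1
  (\<open>antipodal_sum_le_1\<close>). If \<open>f v\<close> were constant, this sum would be \<open>s\<^sup>2 / Q\<close>, hence \<open>f v\<close> must
  deviate from its mean \<open>s / Q\<close>: the squared deviations add up to at least \<open>s\<^sup>2 / Q - 1\<close>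
  (\<open>antipodal_sum_ge\<close>). On the other hand, \<open>S\<close> cannot deviate in many directions at once. Pulled
  back to the matrix space, the deviations for pairwise independent \<open>v\<close> are orthogonal functions,
  and Bessel's inequality for the indicator function of \<open>S\<close> bounds the total of all squared
  deviations by \<open>K s\<close> (\<open>sum_deviation_squares_le\<close>).

  The vectors with a fixed coordinate equal to 1 are pairwise independent, and there are \<open>Q / q\<close> of
  them. Comparing the two estimates gives \<open>(Q / q) (s\<^sup>2 / Q - 1) \<le> K s\<close>, that is
  \<open>s (s - q K) \<le> Q\<close>. As \<open>Q \<le> q K\<close>, this is impossible for \<open>s > q K\<close>.
\<close>

section \<open>Surjective additive maps and matrix actions on vectors\<close>

text \<open>All fibres of a surjective additive map have the same size. To see it at the level of sums,
  translate the argument by a preimage of \<open>z\<close>, which changes nothing, and average over all \<open>z\<close>.\<close>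

lemma sum_surj_additive:
  fixes f :: "'g::{finite,ab_group_add} \<Rightarrow> 'h::{finite,ab_group_add}" and g :: "'h \<Rightarrow> real"
  assumes add: "\<And>x y. f (x + y) = f x + f y" and "surj f"
  shows "real CARD('h) * (\<Sum>x\<in>UNIV. g (f x)) = real CARD('g) * (\<Sum>z\<in>UNIV. g z)"
proof -
  have shift: "(\<Sum>x\<in>UNIV. g (f x)) = (\<Sum>x\<in>UNIV. g (f x + z))" for z
  proof -
    obtain y where y: "f y = z" using \<open>surj f\<close> by (metis surjD)
    have "(\<Sum>x\<in>UNIV. g (f x)) = (\<Sum>x\<in>UNIV. g (f (x + y)))"
      by (rule sum.reindex_bij_witness[of _ "\<lambda>x. x + y" "\<lambda>x. x - y"]) auto
    then show ?thesis by (simp add: add y)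
  qed
  have "real CARD('h) * (\<Sum>x\<in>UNIV. g (f x)) = (\<Sum>z\<in>(UNIV :: 'h set). \<Sum>x\<in>UNIV. g (f x))"
    by simp
  also have "\<dots> = (\<Sum>z\<in>UNIV. \<Sum>x\<in>UNIV. g (f x + z))"
    by (intro sum.cong refl shift)
  also have "\<dots> = (\<Sum>x\<in>UNIV. \<Sum>z\<in>UNIV. g (f x + z))"
    by (rule sum.swap)
  also have "\<dots> = (\<Sum>x\<in>(UNIV :: 'g set). \<Sum>z\<in>UNIV. g z)"
  proof (rule sum.cong[OF refl])
    fix x show "(\<Sum>z\<in>UNIV. g (f x + z)) = (\<Sum>z\<in>UNIV. g z)"
      by (rule sum.reindex_bij_witness[of _ "\<lambda>z. z - f x" "\<lambda>z. f x + z"]) auto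
  qed
  finally show ?thesis by simp
qed

text \<open>The points of projective space outside a coordinate hyperplane, each represented by its
  normalised vector: no two of these vectors are proportional. More than half of all points are covered, and
  the loss against using the whole projective space is harmless.\<close>

definition affine_chart :: "'n \<Rightarrow> ('a::field ^ 'n) set" where
  "affine_chart k = {v. v $ k = 1}"

lemma card_affine_chart:
  "CARD('a) * card (affine_chart k :: ('a::{field,finite} ^ 'n) set) = CARD('a ^ 'n)"
proof -
  have "surj (\<lambda>v :: 'a ^ 'n. v $ k)"
    by (rule surjI[of _ "\<lambda>c. \<chi> i. c"]) simp
  from sum_surj_additive[OF _ this, of "\<lambda>c. if c = 1 then 1 else 0"]
  have "real CARD('a) * real (card (affine_chart k :: ('a ^ 'n) set)) = real CARD('a ^ 'n)"
    by (simp add: affine_chart_def flip: sum.inter_filter)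
  then show ?thesis by (metis of_nat_eq_iff of_nat_mult)
qed

lemma surj_mult_vector:
  fixes v :: "'a::field ^ 'n"
  assumes "v \<in> affine_chart k"
  shows "surj (\<lambda>x :: 'a ^ 'n ^ 'n. x *v v)"
proof (rule surjI)
  fix w :: "'a ^ 'n"
  show "(\<chi> i j. if j = k then w $ i else 0) *v v = w"
    using assms
    by (simp add: affine_chart_def matrix_vector_mult_def vec_eq_iff
        if_distrib[of "\<lambda>a. a * _"] cong: if_cong)
qed

text \<open>Two different vectors of the chart are linearly independent, so their images under a matrix
  can be prescribed freely. They agree in coordinate \<open>k\<close> and differ in some coordinate \<open>l\<close>, so a
  matrix supported on these two columns suffices.\<close>

lemma surj_mult_vector_pair:
  fixes v v' :: "'a::field ^ 'n"
  assumes v: "v \<in> affine_chart k" "v' \<in> affine_chart k" and "v \<noteq> v'"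
  shows "surj (\<lambda>x :: 'a ^ 'n ^ 'n. (x *v v, x *v v'))"
proof -
  obtain l where l: "v $ l \<noteq> v' $ l" using \<open>v \<noteq> v'\<close> by (auto simp: vec_eq_iff)
  then have "l \<noteq> k" using v by (auto simp: affine_chart_def)
  define d where "d = v $ l - v' $ l"
  have "d \<noteq> 0" using l by (simp add: d_def)
  have "\<exists>x :: 'a ^ 'n ^ 'n. (x *v v, x *v v') = (w, w')" for w w'
  proof -
    \<comment> \<open>Cramer's rule for the system \<open>b + c * v $ l = w $ i\<close>, \<open>b + c * v' $ l = w' $ i\<close>, one for
      each row: \<open>c\<close> is the entry in column \<open>l\<close> and \<open>b\<close> the entry in column \<open>k\<close>.\<close>
    define c where "c i = (w $ i - w' $ i) / d" for i
    define x :: "'a ^ 'n ^ 'n"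
      where "x = (\<chi> i j. (if j = l then c i else 0) + (if j = k then w $ i - c i * v $ l else 0))"
    have x: "(x *v u) $ i = c i * u $ l + (w $ i - c i * v $ l) * u $ k" for u i
      by (simp add: x_def matrix_vector_mult_def distrib_right sum.distrib
          if_distrib[of "\<lambda>a. a * _"] cong: if_cong)
    have "c i * d = w $ i - w' $ i" for i using \<open>d \<noteq> 0\<close> by (simp add: c_def)
    then have c: "c i * v $ l - c i * v' $ l = w $ i - w' $ i" for i
      by (simp add: d_def right_diff_distrib)
    have "(x *v v') $ i = w' $ i" for i
      using v c[of i] by (simp add: x affine_chart_def algebra_simps)
    moreover have "(x *v v) $ i = w $ i" for i
      using v by (simp add: x affine_chart_def)
    ultimately show ?thesis by (auto simp: vec_eq_iff)
  qed
  then show ?thesis by (auto simp: surj_def) metis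
qed

section \<open>How unevenly a set of matrices acts on a vector\<close>

definition fibre_size :: "('a::field ^ 'n ^ 'n) set \<Rightarrow> 'a ^ 'n \<Rightarrow> 'a ^ 'n \<Rightarrow> real" where
  "fibre_size S v w = real (card {x \<in> S. x *v v = w})"

definition deviation :: "('a::{field,finite} ^ 'n ^ 'n) set \<Rightarrow> 'a ^ 'n \<Rightarrow> 'a ^ 'n \<Rightarrow> real" where
  "deviation S v w = fibre_size S v w - real (card S) / real CARD('a ^ 'n)"

lemma sum_fibre_size:
  fixes S :: "('a::{field,finite} ^ 'n ^ 'n) set"
  shows "(\<Sum>w\<in>UNIV. fibre_size S v w * g w) = (\<Sum>x\<in>S. g (x *v v))"
proof -
  have "(\<Sum>x\<in>S. g (x *v v)) = (\<Sum>w\<in>UNIV. \<Sum>x | x \<in> S \<and> x *v v = w. g (x *v v))"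
    by (rule sum.group[symmetric]) auto
  also have "\<dots> = (\<Sum>w\<in>UNIV. fibre_size S v w * g w)"
    by (intro sum.cong refl) (simp add: fibre_size_def)
  finally show ?thesis by simp
qed

lemma sum_deviation: "(\<Sum>w\<in>UNIV. deviation S v w) = 0"
  using sum_fibre_size[of S v "\<lambda>_. 1"] by (simp add: deviation_def sum_subtractf)

text \<open>For a uniformly random matrix \<open>x\<close> the vectors \<open>x *v v\<close> and \<open>x *v v'\<close> are independent, and
  each deviation has mean 0.\<close>

lemma deviation_orthogonal:
  fixes S :: "('a::{field,finite} ^ 'n ^ 'n) set"
  assumes v: "v \<in> affine_chart k" "v' \<in> affine_chart k" and "v \<noteq> v'"
  shows "(\<Sum>x\<in>UNIV. deviation S v (x *v v) * deviation S v' (x *v v')) = 0"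
proof -
  have "real CARD(('a ^ 'n) \<times> ('a ^ 'n)) *
      (\<Sum>x\<in>UNIV. deviation S v (x *v v) * deviation S v' (x *v v')) =
    real CARD('a ^ 'n ^ 'n) * (\<Sum>z\<in>UNIV. deviation S v (fst z) * deviation S v' (snd z))"
    using sum_surj_additive[OF _ surj_mult_vector_pair[OF assms],
        of "\<lambda>z. deviation S v (fst z) * deviation S v' (snd z)"]
    by (simp add: matrix_vector_mult_add_rdistrib)
  also have "(\<Sum>z\<in>UNIV. deviation S v (fst z) * deviation S v' (snd z)) =
      (\<Sum>w\<in>UNIV. deviation S v w) * (\<Sum>w\<in>UNIV. deviation S v' w)"
    by (simp add: sum_product sum.cartesian_product case_prod_unfold)
  finally show ?thesis by (simp add: sum_deviation)
qed

text \<open>Bessel's inequality for the indicator function of \<open>S\<close> and the orthogonal functions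
  \<open>x \<mapsto> deviation S v (x *v v)\<close>: both the inner product of such a function with the indicator of
  \<open>S\<close> and its squared norm are multiples of the same sum of squares, by the factors 1 and \<open>K\<close>,
  where \<open>K\<close> is the number of matrices in a fibre of \<open>x \<mapsto> x *v v\<close>.\<close>

lemma sum_deviation_squares_le:
  fixes S :: "('a::{field,finite} ^ 'n ^ 'n) set"
  shows "(\<Sum>v\<in>affine_chart k. \<Sum>w\<in>UNIV. (deviation S v w)\<^sup>2)
    \<le> real CARD('a ^ 'n ^ 'n) / real CARD('a ^ 'n) * real (card S)"
proof -
  define K where "K = real CARD('a ^ 'n ^ 'n) / real CARD('a ^ 'n)"
  define H where "H = (\<Sum>v\<in>affine_chart k. \<Sum>w\<in>UNIV. (deviation S v w)\<^sup>2)"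
  define G where "G x = (\<Sum>v\<in>affine_chart k. deviation S v (x *v v))" for x :: "'a ^ 'n ^ 'n"
  have "K > 0" by (simp add: K_def)
  \<comment> \<open>Sizes and deviations of fibres differ by a constant, which is orthogonal to the deviations.\<close>
  have "(\<Sum>x\<in>S. deviation S v (x *v v)) = (\<Sum>w\<in>UNIV. (deviation S v w)\<^sup>2)" for v
  proof -
    have "(\<Sum>x\<in>S. deviation S v (x *v v)) = (\<Sum>w\<in>UNIV. fibre_size S v w * deviation S v w)"
      by (simp add: sum_fibre_size)
    also have "\<dots> = (\<Sum>w\<in>UNIV. (deviation S v w)\<^sup>2
        + real (card S) / real CARD('a ^ 'n) * deviation S v w)"
      by (intro sum.cong refl) (simp add: deviation_def algebra_simps power2_eq_square)
    finally show ?thesis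
      by (simp only: sum.distrib flip: sum_distrib_left) (simp add: sum_deviation)
  qed
  then have GS: "(\<Sum>x\<in>S. G x) = H"
    unfolding G_def H_def by (subst sum.swap) simp
  have "(\<Sum>v'\<in>affine_chart k. \<Sum>x\<in>UNIV. deviation S v (x *v v) * deviation S v' (x *v v'))
      = K * (\<Sum>w\<in>UNIV. (deviation S v w)\<^sup>2)" if v: "v \<in> affine_chart k" for v
  proof -
    have "(\<Sum>v'\<in>affine_chart k. \<Sum>x\<in>UNIV. deviation S v (x *v v) * deviation S v' (x *v v'))
      = (\<Sum>v'\<in>{v}. \<Sum>x\<in>UNIV. deviation S v (x *v v) * deviation S v' (x *v v'))"
      using v deviation_orthogonal[OF v] by (intro sum.mono_neutral_right) auto
    also have "\<dots> = K * (\<Sum>w\<in>UNIV. (deviation S v w)\<^sup>2)"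
      using sum_surj_additive[OF _ surj_mult_vector[OF v], of "\<lambda>w. (deviation S v w)\<^sup>2"]
      by (simp add: K_def matrix_vector_mult_add_rdistrib field_simps power2_eq_square)
    finally show ?thesis .
  qed
  then have "(\<Sum>v\<in>affine_chart k. \<Sum>v'\<in>affine_chart k.
      \<Sum>x\<in>UNIV. deviation S v (x *v v) * deviation S v' (x *v v')) = K * H"
    by (simp add: H_def sum_distrib_left)
  also have "(\<Sum>v\<in>affine_chart k. \<Sum>v'\<in>affine_chart k.
      \<Sum>x\<in>UNIV. deviation S v (x *v v) * deviation S v' (x *v v')) = (\<Sum>x\<in>UNIV. (G x)\<^sup>2)"
    by (simp only: G_def power2_eq_square sum_product
          sum.swap[where A = "affine_chart k" and B = "UNIV :: ('a ^ 'n ^ 'n) set"])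
  finally have G2: "(\<Sum>x\<in>UNIV. (G x)\<^sup>2) = K * H" .
  \<comment> \<open>\<open>G / K\<close> is the orthogonal projection of the indicator function of \<open>S\<close>; scaling the residual
    by \<open>K\<close> avoids the division.\<close>
  have "0 \<le> (\<Sum>x\<in>UNIV. (K * of_bool (x \<in> S) - G x)\<^sup>2)"
    by (intro sum_nonneg) simp
  also have "\<dots> = (\<Sum>x\<in>UNIV. K\<^sup>2 * of_bool (x \<in> S) - 2 * K * (G x * of_bool (x \<in> S)) + (G x)\<^sup>2)"
    by (intro sum.cong refl) (auto simp: power2_eq_square algebra_simps)
  also have "\<dots> = K\<^sup>2 * card S - 2 * K * H + K * H"
    by (simp add: sum.distrib sum_subtractf G2 flip: sum_distrib_left GS)
  finally have "0 \<le> K * (K * card S - H)"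
    by (simp add: algebra_simps power2_eq_square)
  then show ?thesis
    using \<open>K > 0\<close> unfolding H_def[symmetric] K_def[symmetric] by (simp add: zero_le_mult_iff)
qed

section \<open>Pairs with opposite images\<close>

text \<open>The constant part of the fibre sizes contributes the main term, the cross terms vanish because
  deviations have sum 0, and the correlation of the deviation with its reflection is at least minus
  its squared norm.\<close>

lemma antipodal_sum_ge:
  fixes S :: "('a::{field,finite} ^ 'n ^ 'n) set"
  shows "(real (card S))\<^sup>2 / real CARD('a ^ 'n) - (\<Sum>w\<in>UNIV. (deviation S v w)\<^sup>2)
    \<le> (\<Sum>w\<in>UNIV. fibre_size S v w * fibre_size S v (- w))"
proof -
  define m where "m = real (card S) / real CARD('a ^ 'n)"
  have neg: "(\<Sum>w\<in>UNIV. g (- w)) = (\<Sum>w\<in>UNIV. g w)" for g :: "'a ^ 'n \<Rightarrow> real"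
    by (rule sum.reindex_bij_witness[of _ uminus uminus]) auto
  have "0 \<le> (\<Sum>w\<in>UNIV. (deviation S v w + deviation S v (- w))\<^sup>2)"
    by (intro sum_nonneg) simp
  also have "\<dots> = (\<Sum>w\<in>UNIV. (deviation S v w)\<^sup>2) + (\<Sum>w\<in>UNIV. (deviation S v (- w))\<^sup>2)
      + 2 * (\<Sum>w\<in>UNIV. deviation S v w * deviation S v (- w))"
    by (simp add: power2_sum sum.distrib sum_distrib_left mult.assoc)
  finally have "- (\<Sum>w\<in>UNIV. (deviation S v w)\<^sup>2)
      \<le> (\<Sum>w\<in>UNIV. deviation S v w * deviation S v (- w))"
    by (simp add: neg[of "\<lambda>w. (deviation S v w)\<^sup>2"])
  moreover have "(\<Sum>w\<in>UNIV. fibre_size S v w * fibre_size S v (- w))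
      = (\<Sum>w\<in>UNIV. deviation S v w * deviation S v (- w)
          + m * deviation S v w + m * deviation S v (- w) + m\<^sup>2)"
    by (intro sum.cong refl) (simp only: deviation_def flip: m_def, simp add: algebra_simps power2_eq_square)
  then have "(\<Sum>w\<in>UNIV. fibre_size S v w * fibre_size S v (- w))
      = (\<Sum>w\<in>UNIV. deviation S v w * deviation S v (- w)) + real CARD('a ^ 'n) * m\<^sup>2"
    by (simp add: sum.distrib sum_deviation neg[of "deviation S v"] flip: sum_distrib_left)
  moreover have "real CARD('a ^ 'n) * m\<^sup>2 = (real (card S))\<^sup>2 / real CARD('a ^ 'n)"
    by (simp add: m_def power2_eq_square)
  ultimately show ?thesis by simp
qed

lemma det_eq_0_if_kernel:
  fixes x :: "'a::field ^ 'n ^ 'n"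
  assumes "x *v v = 0" and "v \<noteq> 0"
  shows "det x = 0"
proof (rule ccontr)
  assume "det x \<noteq> 0"
  then obtain y where "y ** x = mat 1" by (auto simp: invertible_det_nz[symmetric] invertible_def)
  then have "v = y *v (x *v v)" by (simp add: matrix_vector_mul_assoc)
  with assms show False by simp
qed

text \<open>Only a pair \<open>(x, x)\<close> can have opposite images, and in odd characteristic this forces
  \<open>x *v v = 0\<close>. Two matrices of \<open>S\<close> that kill \<open>v\<close> have opposite images, too, so there is at most
  one such \<open>x\<close>.\<close>

lemma antipodal_sum_le_1:
  fixes S :: "('a::{field,finite} ^ 'n ^ 'n) set"
  assumes S: "\<And>x y. \<lbrakk>x \<in> S; y \<in> S; x \<noteq> y\<rbrakk> \<Longrightarrow> det (x + y) \<noteq> 0"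
    and "v \<noteq> 0" and two: "(1 + 1 :: 'a) \<noteq> 0"
  shows "(\<Sum>w\<in>UNIV. fibre_size S v w * fibre_size S v (- w)) \<le> 1"
proof -
  have eq: "x = y" if "x \<in> S" "y \<in> S" "x *v v = - (y *v v)" for x y
  proof (rule ccontr)
    assume "x \<noteq> y"
    moreover have "(x + y) *v v = 0" using that by (simp add: matrix_vector_mult_add_rdistrib)
    ultimately show False using S[OF that(1,2)] det_eq_0_if_kernel \<open>v \<noteq> 0\<close> by blast
  qed
  have self: "x *v v = 0" if "x *v v = - (x *v v)" for x :: "'a ^ 'n ^ 'n"
  proof -
    have "x *v v + x *v v = 0" using that by (simp only: eq_neg_iff_add_eq_0)
    then have "(x *v v) $ i + (x *v v) $ i = 0" for i
      by (metis vector_add_component zero_index)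
    then have "(1 + 1) * (x *v v) $ i = 0" for i
      by (simp only: distrib_right mult_1)
    with two have "(x *v v) $ i = 0" for i by (metis mult_eq_0_iff)
    then show ?thesis by (simp add: vec_eq_iff)
  qed
  define P where "P = {x \<in> S. x *v v = 0}"
  have "fibre_size S v (- (x *v v)) = (if x \<in> P then real (card P) else 0)" if "x \<in> S" for x
  proof (cases "x \<in> P")
    case False
    then have "{y \<in> S. y *v v = - (x *v v)} = {}"
      using eq[of _ x] self[of x] \<open>x \<in> S\<close> unfolding P_def by fastforce
    then show ?thesis using False unfolding fibre_size_def by simp
  qed (simp add: fibre_size_def P_def)
  then have "(\<Sum>w\<in>UNIV. fibre_size S v w * fibre_size S v (- w))
      = (\<Sum>x\<in>S. if x \<in> P then real (card P) else 0)"
    by (simp add: sum_fibre_size[of S v "\<lambda>w. fibre_size S v (- w)"])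
  also have "\<dots> = real (card P) * real (card P)"
    by (simp add: P_def flip: sum.inter_filter)
  also have "card P \<le> 1"
    using eq by (intro card_le_Suc0_iff_eq[THEN iffD2, folded One_nat_def]) (auto simp: P_def)
  then have "real (card P) * real (card P) \<le> 1"
    by (intro mult_le_one) auto
  finally show ?thesis .
qed

section \<open>Bounds for the size of an independent set\<close>

text \<open>The two estimates of the deviations, summed over the chart, with denominators cleared.\<close>

lemma card_bound_odd:
  fixes S :: "('a::{field,finite} ^ 'n ^ 'n) set"
  assumes S: "\<And>x y. \<lbrakk>x \<in> S; y \<in> S; x \<noteq> y\<rbrakk> \<Longrightarrow> det (x + y) \<noteq> 0"
    and two: "(1 + 1 :: 'a) \<noteq> 0"
  shows "card S * card S * CARD('a ^ 'n)
    \<le> CARD('a) * CARD('a ^ 'n ^ 'n) * card S + CARD('a ^ 'n) * CARD('a ^ 'n)"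
proof -
  fix k :: 'n
  define q where "q = real CARD('a)"
  define Q where "Q = real CARD('a ^ 'n)"
  define N where "N = real CARD('a ^ 'n ^ 'n)"
  define s where "s = real (card S)"
  define A where "A = (affine_chart k :: ('a ^ 'n) set)"
  have "0 < q" "0 < Q" by (simp_all add: q_def Q_def)
  have "real CARD('a) * real (card A) = real CARD('a ^ 'n)"
    unfolding A_def card_affine_chart[of k, symmetric] by simp
  then have A: "q * real (card A) = Q" by (simp add: q_def Q_def)
  have "s\<^sup>2 / Q - (\<Sum>w\<in>UNIV. (deviation S v w)\<^sup>2) \<le> 1" if "v \<in> A" for v
  proof -
    have "v \<noteq> 0" using that by (auto simp: A_def affine_chart_def)
    with S two have "(\<Sum>w\<in>UNIV. fibre_size S v w * fibre_size S v (- w)) \<le> 1"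
      by (intro antipodal_sum_le_1) auto
    with antipodal_sum_ge[of S v] show ?thesis by (simp add: s_def Q_def)
  qed
  then have "(\<Sum>v\<in>A. s\<^sup>2 / Q - (\<Sum>w\<in>UNIV. (deviation S v w)\<^sup>2)) \<le> (\<Sum>v\<in>A. 1)"
    by (intro sum_mono) auto
  then have "real (card A) * s\<^sup>2 / Q \<le> real (card A) + (\<Sum>v\<in>A. \<Sum>w\<in>UNIV. (deviation S v w)\<^sup>2)"
    by (simp add: sum_subtractf)
  also have "\<dots> \<le> real (card A) + N / Q * s"
    using sum_deviation_squares_le[of S k] by (simp add: A_def N_def Q_def s_def)
  finally have "(q * Q) * (real (card A) * s\<^sup>2 / Q) \<le> (q * Q) * (real (card A) + N / Q * s)"
    using \<open>0 < q\<close> \<open>0 < Q\<close> by (intro mult_left_mono) auto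
  also have "(q * Q) * (real (card A) * s\<^sup>2 / Q) = (q * real (card A)) * s\<^sup>2"
    using \<open>0 < Q\<close> by simp
  also have "(q * Q) * (real (card A) + N / Q * s) = Q * (q * real (card A)) + q * N * s"
    using \<open>0 < Q\<close> by (simp add: field_simps)
  finally have "s * s * Q \<le> q * N * s + Q * Q"
    by (simp add: A power2_eq_square mult_ac add.commute)
  then have "real (card S * card S * CARD('a ^ 'n))
    \<le> real (CARD('a) * CARD('a ^ 'n ^ 'n) * card S + CARD('a ^ 'n) * CARD('a ^ 'n))"
    by (simp add: s_def q_def N_def Q_def)
  then show ?thesis by (simp only: of_nat_le_iff)
qed

text \<open>Here \<open>x + y\<close> is also the difference, so \<open>S\<close> is a code of minimum rank distance \<open>n\<close> and this
  is the Singleton bound.\<close>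

lemma card_bound_char_2:
  fixes S :: "('a::{field,finite} ^ 'n ^ 'n) set"
  assumes S: "\<And>x y. \<lbrakk>x \<in> S; y \<in> S; x \<noteq> y\<rbrakk> \<Longrightarrow> det (x + y) \<noteq> 0"
    and two: "(1 + 1 :: 'a) = 0"
  shows "card S \<le> CARD('a ^ 'n)"
proof -
  define v :: "'a ^ 'n" where "v = (\<chi> i. 1)"
  have "v \<noteq> 0" by (simp add: v_def vec_eq_iff)
  have neg: "- c = c" for c :: 'a
    using two by (metis add_eq_0_iff2 distrib_right mult_1 mult_zero_left)
  have "inj_on (\<lambda>x. x *v v) S"
  proof (rule inj_onI, rule ccontr)
    fix x y assume xy: "x \<in> S" "y \<in> S" "x *v v = y *v v" "x \<noteq> y"
    have "- (y *v v) = y *v v" by (simp add: vec_eq_iff neg)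
    then have "(x + y) *v v = 0"
      using xy(3) by (metis add.right_inverse matrix_vector_mult_add_rdistrib)
    with S[OF xy(1,2,4)] det_eq_0_if_kernel \<open>v \<noteq> 0\<close> show False by blast
  qed
  then show ?thesis by (rule card_inj_on_le) auto
qed

theorem theorem1p3:
  fixes q n :: nat
  assumes "CARD('a::{field,finite}) = q"
    and "CARD('n::finite) = n"
    and "n \<ge> 2"
  shows "independence_number (total_graph :: ('a ^ 'n ^ 'n) pair_pre_digraph) \<le> q ^ (n\<^sup>2 - n + 1)"
proof -
  obtain S :: "('a ^ 'n ^ 'n) set"
    where ind: "independent_in total_graph S"
      and card: "card S = independence_number (total_graph :: ('a ^ 'n ^ 'n) pair_pre_digraph)"
    using independence_number_attained(1)[of total_graph] by (auto simp: total_graph_def)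
  have S: "det (x + y) \<noteq> 0" if "x \<in> S" "y \<in> S" "x \<noteq> y" for x y
    using ind that by (auto simp: independent_in_def total_graph_def)
  define s where "s = card S"
  define B where "B = q ^ (n\<^sup>2 - n + 1)"
  have Q: "CARD('a ^ 'n) = q ^ n" and N: "CARD('a ^ 'n ^ 'n) = q ^ (n\<^sup>2)"
    using assms(1,2) by (simp_all add: power2_eq_square power_mult)
  have "0 < q" using assms(1) by auto
  have "n \<le> n\<^sup>2" by (simp add: power2_eq_square)
  have "2 * n \<le> n\<^sup>2" unfolding power2_eq_square using assms(3) by (rule mult_le_mono1)
  then have "n \<le> n\<^sup>2 - n + 1" by linarith
  then have QB: "q ^ n \<le> B"
    unfolding B_def using \<open>0 < q\<close> by (intro power_increasing) auto
  have "s \<le> B"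
  proof (cases "(1 + 1 :: 'a) = 0")
    case True
    with S have "card S \<le> CARD('a ^ 'n)" by (intro card_bound_char_2) auto
    with QB show ?thesis by (simp add: s_def assms(1,2))
  next
    case False
    have "q * q ^ (n\<^sup>2) = B * q ^ n"
    proof -
      have "Suc (n\<^sup>2) = (n\<^sup>2 - n + 1) + n" using \<open>n \<le> n\<^sup>2\<close> by simp
      then show ?thesis unfolding B_def by (metis power_Suc power_add)
    qed
    moreover have "card S * card S * CARD('a ^ 'n)
        \<le> CARD('a) * CARD('a ^ 'n ^ 'n) * card S + CARD('a ^ 'n) * CARD('a ^ 'n)"
      using S False by (intro card_bound_odd) auto
    ultimately have "s * s * q ^ n \<le> (B * s + q ^ n) * q ^ n"
      unfolding Q N assms(1) s_def[symmetric] by (simp only: mult_ac distrib_left)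
    then have *: "s * s \<le> B * s + q ^ n" using \<open>0 < q\<close> by simp
    show "s \<le> B"
    proof (rule ccontr)
      assume "\<not> s \<le> B"
      then have "(B + 1) * s \<le> s * s" by (intro mult_le_mono1) simp
      with * have "s \<le> q ^ n" by simp
      with QB \<open>\<not> s \<le> B\<close> show False by simp
    qed
  qed
  then show ?thesis by (simp add: s_def B_def card)
qed

end
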